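(* Let $n\geq3$, let $T$ be the $n$-regular tree, let $l$ be a legal labelling of $T$, and let $F\leq S_n$. Then there exists a uniform lattice $\Lambda\leq U^{(l)}(F)$ such that for every free uniform lattice $\Gamma\leq U^{(l)}(F)$ there is $g\in U^{(l)}(F)$ with $g\Gamma g^{-1}\leq\Lambda$.
   Context: $VT$ is the vertex set of $T$ and $ET$ is the set of oriented edges; each $e\in ET$ has an origin $o(e)$, a terminus $t(e)$ and an inverse edge $\bar e$ (same edge with reversed orientation). $E(x)$ is the set of $e\in ET$ with $o(e)=x$. $\operatorname{Aut}(T)$ is the automorphism group of $T$ (inversions allowed). $S_n$ is the symmetric group on $\{1,\dots,n\}$. A legal labelling of $T$ is a map $l:ET\to\{1,\dots,n\}$ such that for every $x\in VT$ the map $l_x:E(x)\to\{1,\dots,n\}$, $e\mapsto l(e)$, is a bijection, and $l(e)=l(\bar e)$ for all $e\in ET$. The universal group of $T$ with respect to $l$ and $F$ is $$U^{(l)}(F)=\{g\in\operatorname{Aut}(T)\mid l_{gx}\circ g\circ l_x^{-1}\in F\text{ for all }x\in VT\},$$ where $g$ here denotes the induced bijection $E(x)\to E(gx)$. A subgroup $\Gamma\leq\operatorname{Aut}(T)$ is a uniform lattice if it acts properly and cocompactly on $T$, i.e. its action on $VT$ has finite stabilisers and finitely many orbits; a uniform lattice in $U^{(l)}(F)$ is a uniform lattice of $\operatorname{Aut}(T)$ contained in $U^{(l)}(F)$. It is free if it acts freely on $T$ (no non-trivial element fixes a point of $T$; in particular no element inverts an edge). *)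

theory Defs
  imports
    "Graph_Theory.Graph_Theory"
    "HOL-Algebra.Group_Action"
    "HOL-Algebra.Sym_Groups"
begin

text \<open>
  Graphs in the sense of Serre are the \<^locale>\<open>bidirected_digraph\<close>s: the arcs are the oriented
  edges, with origin \<^const>\<open>tail\<close> and terminus \<^const>\<open>head\<close>, and \<open>arev\<close> is the
  fixed-point-free involution reversing orientation. An edge together with its inverse always forms
  a directed cycle \<open>[e, arev e]\<close>, so the library's \<^const>\<open>forest\<close> does not apply to them. The
  circuits of a Serre graph are the remaining cycles: loops, pairs of distinct edges with the same
  two endpoints, and closed paths through at least three distinct vertices.
\<close>

definition circuit :: "('v, 'e) pre_digraph \<Rightarrow> ('e \<Rightarrow> 'e) \<Rightarrow> 'e list \<Rightarrow> bool" where
  "circuit T arev p \<longleftrightarrow> pre_digraph.cycle T p \<and> (\<nexists>e. p = [e, arev e])"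

definition serre_tree :: "('v, 'e) pre_digraph \<Rightarrow> ('e \<Rightarrow> 'e) \<Rightarrow> bool" where
  "serre_tree T arev \<longleftrightarrow>
     bidirected_digraph T arev \<and> connected T \<and> (\<nexists>p. circuit T arev p)"

definition regular_tree :: "nat \<Rightarrow> ('v, 'e) pre_digraph \<Rightarrow> ('e \<Rightarrow> 'e) \<Rightarrow> bool" where
  "regular_tree n T arev \<longleftrightarrow>
     serre_tree T arev \<and> (\<forall>x \<in> verts T. finite (out_arcs T x) \<and> card (out_arcs T x) = n)"

text \<open>
  An automorphism is a pair of a vertex map and an edge map. Both are the identity outside the
  graph (\<open>permutes\<close>), so that distinct pairs are distinct automorphisms. An automorphism may send
  an edge to its inverse.
\<close>

definition aut_group ::
    "('v, 'e) pre_digraph \<Rightarrow> ('e \<Rightarrow> 'e) \<Rightarrow> (('v \<Rightarrow> 'v) \<times> ('e \<Rightarrow> 'e)) monoid" where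
  "aut_group T arev =
     \<lparr> carrier = {(gV, gE). gV permutes verts T \<and> gE permutes arcs T \<and>
         (\<forall>e \<in> arcs T. tail T (gE e) = gV (tail T e) \<and> head T (gE e) = gV (head T e) \<and>
            gE (arev e) = arev (gE e))},
       mult = (\<lambda>g h. (fst g \<circ> fst h, snd g \<circ> snd h)),
       one = (id, id) \<rparr>"

definition legal_labelling ::
    "nat \<Rightarrow> ('v, 'e) pre_digraph \<Rightarrow> ('e \<Rightarrow> 'e) \<Rightarrow> ('e \<Rightarrow> nat) \<Rightarrow> bool" where
  "legal_labelling n T arev l \<longleftrightarrow>
     (\<forall>x \<in> verts T. bij_betw l (out_arcs T x) {1..n}) \<and> (\<forall>e \<in> arcs T. l (arev e) = l e)"

text \<open>
  The permutation \<open>l\<^bsub>gx\<^esub> \<circ> g \<circ> l\<^sub>x\<inverse>\<close> of \<open>{1..n}\<close>, extended by the identity to all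
  natural numbers as in \<^const>\<open>sym_group\<close>.
\<close>

definition local_action ::
    "nat \<Rightarrow> ('v, 'e) pre_digraph \<Rightarrow> ('e \<Rightarrow> nat) \<Rightarrow> ('v \<Rightarrow> 'v) \<times> ('e \<Rightarrow> 'e) \<Rightarrow> 'v \<Rightarrow> nat \<Rightarrow> nat"
  where
  "local_action n T l g x =
     restrict_id (l \<circ> snd g \<circ> inv_into (out_arcs T x) l) {1..n}"

definition universal_group ::
    "nat \<Rightarrow> ('v, 'e) pre_digraph \<Rightarrow> ('e \<Rightarrow> 'e) \<Rightarrow> ('e \<Rightarrow> nat) \<Rightarrow> (nat \<Rightarrow> nat) set \<Rightarrow>
       (('v \<Rightarrow> 'v) \<times> ('e \<Rightarrow> 'e)) set" where
  "universal_group n T arev l F =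
     {g \<in> carrier (aut_group T arev). \<forall>x \<in> verts T. local_action n T l g x \<in> F}"

definition uniform_lattice ::
    "('v, 'e) pre_digraph \<Rightarrow> ('e \<Rightarrow> 'e) \<Rightarrow> (('v \<Rightarrow> 'v) \<times> ('e \<Rightarrow> 'e)) set \<Rightarrow> bool" where
  "uniform_lattice T arev \<Gamma> \<longleftrightarrow>
     subgroup \<Gamma> (aut_group T arev) \<and>
     (\<forall>x \<in> verts T. finite (stabilizer ((aut_group T arev)\<lparr>carrier := \<Gamma>\<rparr>) fst x)) \<and>
     finite (orbits ((aut_group T arev)\<lparr>carrier := \<Gamma>\<rparr>) (verts T) fst)"

text \<open>
  An automorphism fixes a point of the geometric realisation iff it fixes a vertex, fixes an
  edge, or inverts an edge (and so fixes its midpoint).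
\<close>

definition acts_freely ::
    "('v, 'e) pre_digraph \<Rightarrow> ('e \<Rightarrow> 'e) \<Rightarrow> (('v \<Rightarrow> 'v) \<times> ('e \<Rightarrow> 'e)) set \<Rightarrow> bool" where
  "acts_freely T arev \<Gamma> \<longleftrightarrow>
     (\<forall>g \<in> \<Gamma>. g \<noteq> \<one>\<^bsub>aut_group T arev\<^esub> \<longrightarrow>
        (\<forall>x \<in> verts T. fst g x \<noteq> x) \<and> (\<forall>e \<in> arcs T. snd g e \<noteq> e \<and> snd g e \<noteq> arev e))"

lemma aut_group_is_group:
  assumes "bidirected_digraph T arev"
  shows "group (aut_group T arev)"
proof -
  interpret bidirected_digraph T arev by fact
  show ?thesis
  proof (rule groupI)
    fix g h assume g: "g \<in> carrier (aut_group T arev)" and h: "h \<in> carrier (aut_group T arev)"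
    have "snd h e \<in> arcs T" if "e \<in> arcs T" for e
      using h that permutes_in_image by (fastforce simp: aut_group_def)
    with g h show "g \<otimes>\<^bsub>aut_group T arev\<^esub> h \<in> carrier (aut_group T arev)"
      by (auto simp: aut_group_def permutes_compose)
  next
    fix g assume g: "g \<in> carrier (aut_group T arev)"
    obtain a b where ab: "g = (a, b)" by force
    have a: "a permutes verts T" and b: "b permutes arcs T"
      and m: "\<And>e. e \<in> arcs T \<Longrightarrow> tail T (b e) = a (tail T e)"
         "\<And>e. e \<in> arcs T \<Longrightarrow> head T (b e) = a (head T e)"
         "\<And>e. e \<in> arcs T \<Longrightarrow> b (arev e) = arev (b e)"
      using g by (auto simp: ab aut_group_def)
    have "tail T (Hilbert_Choice.inv b e) = Hilbert_Choice.inv a (tail T e) \<and> head T (Hilbert_Choice.inv b e) = Hilbert_Choice.inv a (head T e) \<and>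
        Hilbert_Choice.inv b (arev e) = arev (Hilbert_Choice.inv b e)" if e: "e \<in> arcs T" for e
    proof -
      have e': "Hilbert_Choice.inv b e \<in> arcs T" using e b by (simp add: permutes_in_image permutes_inv)
      have "b (Hilbert_Choice.inv b e) = e" using b by (simp add: permutes_inverses)
      with m[OF e'] show ?thesis using a b by (metis permutes_inverses(2))
    qed
    then have "(Hilbert_Choice.inv a, Hilbert_Choice.inv b) \<in> carrier (aut_group T arev)"
      using a b by (simp add: aut_group_def permutes_inv)
    moreover have "(Hilbert_Choice.inv a, Hilbert_Choice.inv b) \<otimes>\<^bsub>aut_group T arev\<^esub> g = \<one>\<^bsub>aut_group T arev\<^esub>"
      using a b by (simp add: aut_group_def ab permutes_inv_o)
    ultimately show "\<exists>h \<in> carrier (aut_group T arev).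
        h \<otimes>\<^bsub>aut_group T arev\<^esub> g = \<one>\<^bsub>aut_group T arev\<^esub>" by blast
  qed (auto simp: aut_group_def permutes_id comp_assoc)
qed

end

theory Submission
  imports Defs
begin

text \<open>
  Identify the star of each vertex with \<open>{1..n}\<close> through \<open>l\<close>, and write \<open>\<sigma> g x\<close> for the local
  action of \<open>g\<close> at \<open>x\<close>. The lattice is the group \<open>\<Lambda>\<close> of all automorphisms whose local
  action is one and the same element of \<open>F\<close> at every vertex. It contains every
  label-preserving automorphism, and these act transitively on the vertices; and an element fixing a
  vertex is determined by its constant local action, so that vertex stabilisers embed in \<open>F\<close> and are
  finite (\<open>\<Lambda>_uniform_lattice\<close>).

  Conjugating a group \<open>\<Gamma>\<close> by some \<open>g\<close> amounts to keeping \<open>\<Gamma>\<close> and replacing \<open>l\<close> by the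
  legal labelling \<open>l' = l \<circ> g\<close>. So one has to find a legal labelling \<open>l'\<close>, differing from \<open>l\<close>
  at each vertex by an element of \<open>F\<close>, with respect to which every element of \<open>\<Gamma>\<close> has constant
  local action. Such a labelling comes from a flat connection: to each edge \<open>e\<close> from \<open>x\<close> to
  \<open>y\<close> assign a bijection from the star of \<open>x\<close> to the star of \<open>y\<close> that takes \<open>e\<close> to its
  inverse, belongs to \<open>F\<close> in the labels, and depends equivariantly on \<open>e\<close> under \<open>\<Gamma>\<close>, the
  inverse edge receiving the inverse bijection. As \<open>\<Gamma>\<close> acts freely and without inversions, the bijection
  can be chosen to preserve labels on one edge of each orbit of unoriented edges and is then
  propagated by \<open>\<Gamma>\<close> without conflict (\<open>equivariant_star_identification\<close>).

  Since \<open>T\<close> is a tree, parallel transport along this connection is independent of the path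
  (\<open>transport_exists\<close>). Transporting the labels at a base vertex gives \<open>l'\<close>: it
  is legal because each bijection takes \<open>e\<close> to its inverse, and an element of \<open>\<Gamma>\<close> has
  constant local action because it commutes with transport. An automorphism \<open>g\<close> with \<open>l \<circ> g = l'\<close>
  is again built by transport (\<open>aut_carrying_labelling\<close>).
\<close>

section \<open>Transport on a tree\<close>

text \<open>
  The cycle is a contiguous piece of the walk, so that it can be cut out.
\<close>

lemma (in wf_digraph) closed_walk_contains_cycle:
  assumes "awalk u p u" "p \<noteq> []"
  shows "\<exists>q r s. p = q @ r @ s \<and> cycle r"
  using assms
proof (induction "length p" arbitrary: p u rule: less_induct)
  case less
  show ?case
  proof (cases "distinct (tl (awalk_verts u p))")
    case True
    then have "cycle p" using less.prems by (auto simp: cycle_def)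
    then show ?thesis by (metis append_Nil append_Nil2)
  next
    case False
    obtain e p' where p: "p = e # p'" using less.prems by (cases p) auto
    have "awalk (head G e) p' u" "\<not> distinct (awalk_verts (head G e) p')"
      using less.prems False by (auto simp: p awalk_Cons_iff)
    from awalk_cyc_decompE'[OF this] obtain q r s
      where d: "p' = q @ r @ s" "closed_w r" by metis
    then obtain v where v: "awalk v r v" "r \<noteq> []" by (auto simp: closed_w_def)
    have "length r < length p" by (simp add: p d)
    from less.hyps[OF this v] obtain q' r' s' where "r = q' @ r' @ s'" "cycle r'" by blast
    then have "p = (e # q @ q') @ r' @ (s' @ s) \<and> cycle r'" by (simp add: p d)
    then show ?thesis by blast
  qed
qed

context bidirected_digraph
begin

text \<open>
  Read \<open>\<tau> e\<close> as a bijection of the fibre \<open>A\<close> over the tail of \<open>e\<close> with the fibre over its head.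
  In a tree the only cycles are backtrackings \<open>[e, arev e]\<close>, along which the transport cancels.
  Deleting one of them leaves a shorter closed walk with the same transport.
\<close>

lemma transport_closed_walk:
  assumes tree: "serre_tree G arev"
    and A: "\<And>e a. e \<in> arcs G \<Longrightarrow> a \<in> A \<Longrightarrow> \<tau> e a \<in> A"
    and inv: "\<And>e a. e \<in> arcs G \<Longrightarrow> a \<in> A \<Longrightarrow> \<tau> (arev e) (\<tau> e a) = a"
    and "awalk u p u" "a \<in> A"
  shows "fold \<tau> p a = a"
  using assms(4,5)
proof (induction "length p" arbitrary: p rule: less_induct)
  case less
  show ?case
  proof (cases "p = []")
    case False
    then obtain q r s where p: "p = q @ r @ s" and "cycle r"
      using closed_walk_contains_cycle less.prems by metis
    with tree obtain e where r: "r = [e, arev e]"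
      by (auto simp: serre_tree_def circuit_def)
    have w: "awalk u (q @ [e, arev e] @ s) u" using less.prems by (simp add: p r)
    then have e: "e \<in> arcs G" and "set q \<subseteq> arcs G" by auto
    then have "fold \<tau> q a \<in> A" using \<open>a \<in> A\<close> by (induction q arbitrary: a) (auto intro: A)
    then have "fold \<tau> p a = fold \<tau> (q @ s) a" by (simp add: p r inv[OF e])
    moreover have "awalk u (q @ s) u"
      using w e by (auto simp: awalk_Cons_iff)
    moreover have "length (q @ s) < length p" by (simp add: p r)
    ultimately show ?thesis using less.hyps[of "q @ s"] less.prems by simp
  qed simp
qed

lemma strongly_connected_if_serre_tree:
  "serre_tree G arev \<Longrightarrow> strongly_connected G"
  using symmetric_connected_imp_strongly_connected sym_arcs by (auto simp: serre_tree_def)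

lemma serre_tree_induct [consumes 3, case_names base step]:
  assumes "serre_tree G arev" "x0 \<in> verts G" "x \<in> verts G"
    and "P x0"
    and "\<And>e. e \<in> arcs G \<Longrightarrow> P (tail G e) \<Longrightarrow> P (head G e)"
  shows "P x"
proof -
  have "x0 \<rightarrow>\<^sup>*\<^bsub>G\<^esub> x"
    using strongly_connected_if_serre_tree assms(1-3) by (auto simp: strongly_connected_def)
  then obtain p where "awalk x0 p x" by (auto simp: reachable_awalk)
  then show ?thesis using assms(4)
    by (induction p arbitrary: x0) (auto simp: awalk_simps intro: assms(5))
qed

text \<open>
  A flat connection on a tree has a global parallel section with any prescribed value at a base
  vertex: transport that value along an arbitrary walk.
\<close>

lemma transport_exists:
  assumes tree: "serre_tree G arev"
    and A: "\<And>e a. e \<in> arcs G \<Longrightarrow> a \<in> A \<Longrightarrow> \<tau> e a \<in> A"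
    and inv: "\<And>e a. e \<in> arcs G \<Longrightarrow> a \<in> A \<Longrightarrow> \<tau> (arev e) (\<tau> e a) = a"
    and x0: "x0 \<in> verts G" and a0: "a0 \<in> A"
  obtains P where "P x0 = a0" "\<And>x. x \<in> verts G \<Longrightarrow> P x \<in> A"
    "\<And>e. e \<in> arcs G \<Longrightarrow> P (head G e) = \<tau> e (P (tail G e))"
proof
  define w where "w x = (SOME p. awalk x0 p x)" for x
  define P where "P x = fold \<tau> (w x) a0" for x
  have fold_A: "fold \<tau> p a \<in> A" if "set p \<subseteq> arcs G" "a \<in> A" for p a
    using that by (induction p arbitrary: a) (auto intro: A)
  have w: "awalk x0 (w x) x" if "x \<in> verts G" for x
  proof -
    have "x0 \<rightarrow>\<^sup>*\<^bsub>G\<^esub> x"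
      using strongly_connected_if_serre_tree tree x0 that by (auto simp: strongly_connected_def)
    then show ?thesis unfolding w_def by (metis reachable_awalk someI_ex)
  qed
  show P_A: "P x \<in> A" if "x \<in> verts G" for x
    unfolding P_def using w[OF that] a0 by (intro fold_A) auto
  show "P x0 = a0"
    unfolding P_def using transport_closed_walk[OF tree, of A \<tau>] A inv w[OF x0] a0 by blast
  show "P (head G e) = \<tau> e (P (tail G e))" if e: "e \<in> arcs G" for e
  proof -
    let ?x = "tail G e" and ?y = "head G e"
    have wx: "awalk x0 (w ?x) ?x" and wy: "awalk x0 (w ?y) ?y" using e w by auto
    \<comment> \<open>Reversing a walk inverts its transport.\<close>
    have rev: "fold \<tau> (rev (map arev p)) (fold \<tau> p a) = a"
      if "set p \<subseteq> arcs G" "a \<in> A" for p a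
      using that by (induction p arbitrary: a) (auto simp: A inv)
    have rev_walk: "awalk v (rev (map arev p)) u" if "awalk u p v" for u p v
      using that
    proof (induction p arbitrary: u)
      case (Cons a p)
      then have "a \<in> arcs G" "u = tail G a" "awalk v (rev (map arev p)) (head G a)"
        by (auto simp: awalk_Cons_iff)
      then show ?case by (auto simp: awalk_simps awalk_append_iff)
    qed (auto simp: awalk_simps)
    \<comment> \<open>Go out through \<open>e\<close> and come back along the walk chosen for the other endpoint.\<close>
    have "awalk x0 (w ?x @ e # rev (map arev (w ?y))) x0"
      using e wx wy rev_walk[OF wy] by (auto simp: awalk_Cons_iff)
    from transport_closed_walk[OF tree, of A \<tau>, OF A inv this a0]
    have return: "fold \<tau> (rev (map arev (w ?y))) (\<tau> e (P ?x)) = a0" by (simp add: P_def)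
    have tA: "\<tau> e (P ?x) \<in> A" using A P_A e by auto
    have sub: "set (rev (map arev (w ?y))) \<subseteq> arcs G" using rev_walk[OF wy] by blast
    have "rev (map arev (rev (map arev (w ?y)))) = w ?y"
      by (simp add: rev_map comp_def)
    then show ?thesis using rev[OF sub tA] return by (simp add: P_def)
  qed
qed

end

section \<open>Graph maps determined by a labelling\<close>

definition graph_map :: "('v, 'e) pre_digraph \<Rightarrow> ('v \<Rightarrow> 'v) \<Rightarrow> ('e \<Rightarrow> 'e) \<Rightarrow> bool" where
  "graph_map T f h \<longleftrightarrow> (\<forall>x \<in> verts T. f x \<in> verts T) \<and>
     (\<forall>e \<in> arcs T. h e \<in> arcs T \<and> tail T (h e) = f (tail T e) \<and> head T (h e) = f (head T e))"

lemma graph_map_comp: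
  "graph_map T f h \<Longrightarrow> graph_map T f' h' \<Longrightarrow> graph_map T (f' \<circ> f) (h' \<circ> h)"
  by (simp add: graph_map_def)

lemma graph_map_if_aut: "g \<in> carrier (aut_group T arev) \<Longrightarrow> graph_map T (fst g) (snd g)"
  by (auto simp: aut_group_def graph_map_def permutes_in_image)

lemma aut_eqI:
  assumes "g \<in> carrier (aut_group T arev)" "h \<in> carrier (aut_group T arev)"
    and "\<And>x. x \<in> verts T \<Longrightarrow> fst g x = fst h x" "\<And>e. e \<in> arcs T \<Longrightarrow> snd g e = snd h e"
  shows "g = h"
proof (rule prod_eqI)
  show "fst g = fst h"
    using assms by (intro ext) (auto simp: aut_group_def permutes_def, metis)
  show "snd g = snd h"
    using assms by (intro ext) (auto simp: aut_group_def permutes_def, metis)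
qed

lemma legal_labelling_injD:
  assumes "legal_labelling n T arev l" "wf_digraph T"
    and "e \<in> arcs T" "e' \<in> arcs T" "tail T e = tail T e'" "l e = l e'"
  shows "e = e'"
proof -
  have "inj_on l (out_arcs T (tail T e))"
    using assms(1-3) by (auto simp: legal_labelling_def bij_betw_def wf_digraph.tail_in_verts)
  then show ?thesis using assms(3-6) by (auto simp: inj_on_def)
qed

lemma legal_labelling_surjD:
  assumes "legal_labelling n T arev l" "x \<in> verts T" "i \<in> {1..n}"
  obtains e where "e \<in> arcs T" "tail T e = x" "l e = i"
proof -
  have "l ` out_arcs T x = {1..n}"
    using assms(1,2) by (auto simp: legal_labelling_def bij_betw_def)
  with assms(3) have "i \<in> l ` out_arcs T x" by simp
  then show ?thesis using that by auto
qed

lemma legal_labelling_range: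
  assumes "legal_labelling n T arev l" "wf_digraph T" "e \<in> arcs T"
  shows "l e \<in> {1..n}"
proof -
  have "l ` out_arcs T (tail T e) = {1..n}"
    using assms by (simp add: legal_labelling_def bij_betw_def wf_digraph.tail_in_verts)
  moreover have "e \<in> out_arcs T (tail T e)" using assms(3) by simp
  ultimately show ?thesis by blast
qed

context bidirected_digraph
begin

text \<open>
  The image of an edge is determined by the image of its origin and by the label of the image, so that
  the value at one vertex propagates to the whole tree.
\<close>

lemma graph_map_unique:
  assumes tree: "serre_tree G arev" and l: "legal_labelling n G arev l"
    and f: "graph_map G f h" and f': "graph_map G f' h'"
    and x0: "x0 \<in> verts G" "f x0 = f' x0"
    and eq: "\<And>e. e \<in> arcs G \<Longrightarrow> l (h e) = l (h' e)"
  shows "x \<in> verts G \<Longrightarrow> f x = f' x" "e \<in> arcs G \<Longrightarrow> h e = h' e"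
proof -
  have inj: "h e = h' e" if "e \<in> arcs G" "f (tail G e) = f' (tail G e)" for e
    using legal_labelling_injD[OF l wf_digraph_axioms, of "h e" "h' e"] that f f' eq
    by (auto simp: graph_map_def)
  show V: "f x = f' x" if "x \<in> verts G" for x
    using tree x0(1) that
  proof (induction rule: serre_tree_induct)
    case (step e)
    then show ?case using f f' inj by (metis graph_map_def)
  qed (fact x0(2))
  show "h e = h' e" if "e \<in> arcs G"
    using inj V that by simp
qed

text \<open>
  The vertex map is a parallel section: crossing \<open>e\<close>, the image point crosses the edge that carries
  the label \<open>l' e\<close> in \<open>l\<close>. Crossing back undoes this, as both labellings are invariant under
  reversal.
\<close>

lemma graph_map_exists:
  assumes tree: "serre_tree G arev"
    and l: "legal_labelling n G arev l" and l': "legal_labelling n G arev l'"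
    and x0: "x0 \<in> verts G" and y0: "y0 \<in> verts G"
  obtains f h where "graph_map G f h" "f x0 = y0" "\<And>e. e \<in> arcs G \<Longrightarrow> l (h e) = l' e"
proof -
  define arc_at where "arc_at y i = (SOME e. e \<in> arcs G \<and> tail G e = y \<and> l e = i)" for y i
  have arc_at: "arc_at y (l' e) \<in> arcs G" "tail G (arc_at y (l' e)) = y" "l (arc_at y (l' e)) = l' e"
    if "y \<in> verts G" "e \<in> arcs G" for y e
  proof -
    have "\<exists>a. a \<in> arcs G \<and> tail G a = y \<and> l a = l' e"
      using legal_labelling_surjD[OF l that(1) legal_labelling_range[OF l' wf_digraph_axioms that(2)]]
      by metis
    from someI_ex[OF this] show "arc_at y (l' e) \<in> arcs G" "tail G (arc_at y (l' e)) = y"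
      "l (arc_at y (l' e)) = l' e" by (auto simp: arc_at_def)
  qed
  define \<tau> where "\<tau> e y = head G (arc_at y (l' e))" for e y
  have A: "\<tau> e y \<in> verts G" if "e \<in> arcs G" "y \<in> verts G" for e y
    using arc_at[OF that(2,1)] by (simp add: \<tau>_def)
  have inv: "\<tau> (arev e) (\<tau> e y) = y" if "e \<in> arcs G" "y \<in> verts G" for e y
  proof -
    let ?a = "arc_at y (l' e)"
    note a = arc_at[OF that(2,1)]
    have e': "l' (arev e) = l' e" "l (arev ?a) = l ?a"
      using l l' that a by (auto simp: legal_labelling_def)
    have "arc_at (head G ?a) (l' (arev e)) = arev ?a"
      using arc_at[of "head G ?a" "arev e"] a e' that
      by (intro legal_labelling_injD[OF l wf_digraph_axioms]) auto
    then show ?thesis using a by (simp add: \<tau>_def)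
  qed
  obtain f where f: "f x0 = y0" "\<And>x. x \<in> verts G \<Longrightarrow> f x \<in> verts G"
    "\<And>e. e \<in> arcs G \<Longrightarrow> f (head G e) = \<tau> e (f (tail G e))"
    using transport_exists[OF tree, of "verts G" \<tau>, OF A inv x0 y0] by blast
  define h where "h e = arc_at (f (tail G e)) (l' e)" for e
  show ?thesis
  proof (rule that)
    show "graph_map G f h" using f arc_at by (auto simp: graph_map_def h_def \<tau>_def)
    show "f x0 = y0" by (fact f)
    show "l (h e) = l' e" if "e \<in> arcs G" for e using that f arc_at by (auto simp: h_def)
  qed
qed

text \<open>
  By rigidity, the map carrying \<open>l'\<close> to \<open>l\<close> and the one carrying \<open>l\<close> back to \<open>l'\<close> are
  inverse to each other. With \<open>l' = l\<close> this yields vertex-transitivity of the label-preserving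
  automorphisms.
\<close>

lemma aut_carrying_labelling:
  assumes tree: "serre_tree G arev"
    and l: "legal_labelling n G arev l" and l': "legal_labelling n G arev l'"
    and x0: "x0 \<in> verts G" and y0: "y0 \<in> verts G"
  obtains g where "g \<in> carrier (aut_group G arev)" "fst g x0 = y0"
    "\<And>e. e \<in> arcs G \<Longrightarrow> l (snd g e) = l' e"
proof -
  obtain f h where f: "graph_map G f h" "f x0 = y0" "\<And>e. e \<in> arcs G \<Longrightarrow> l (h e) = l' e"
    using graph_map_exists[OF tree l l' x0 y0] by blast
  obtain f' h' where f': "graph_map G f' h'" "f' y0 = x0" "\<And>e. e \<in> arcs G \<Longrightarrow> l' (h' e) = l e"
    using graph_map_exists[OF tree l' l y0 x0] by blast
  have id: "graph_map G id id" by (simp add: graph_map_def)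
  have arcs: "h e \<in> arcs G" "h' e \<in> arcs G" if "e \<in> arcs G" for e
    using that f f' by (auto simp: graph_map_def)
  have 1: "x \<in> verts G \<Longrightarrow> f' (f x) = x" "e \<in> arcs G \<Longrightarrow> h' (h e) = e" for x e
    using graph_map_unique[OF tree l' graph_map_comp[OF f(1) f'(1)] id x0] f f' arcs by auto
  have 2: "x \<in> verts G \<Longrightarrow> f (f' x) = x" "e \<in> arcs G \<Longrightarrow> h (h' e) = e" for x e
    using graph_map_unique[OF tree l graph_map_comp[OF f'(1) f(1)] id y0] f f' arcs by auto
  have bij: "bij_betw f (verts G) (verts G)" "bij_betw h (arcs G) (arcs G)"
    using 1 2 f(1) f'(1)
    by (auto intro!: bij_betw_byWitness[where f' = f'] bij_betw_byWitness[where f' = h']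
        simp: graph_map_def)
  have rev: "h (arev e) = arev (h e)" if e: "e \<in> arcs G" for e
    using f l l' e arcs[OF e] arcs[of "arev e"]
    by (intro legal_labelling_injD[OF l wf_digraph_axioms]) (auto simp: graph_map_def legal_labelling_def)
  show ?thesis
  proof (rule that)
    show "(restrict_id f (verts G), restrict_id h (arcs G)) \<in> carrier (aut_group G arev)"
      using bij rev f(1) by (auto simp: aut_group_def graph_map_def permutes_restrict_id)
  qed (use f x0 in auto)
qed

end

section \<open>Local actions\<close>

locale labelled_tree = bidirected_digraph T arev
  for T :: "('v, 'e) pre_digraph" and arev :: "'e \<Rightarrow> 'e" +
  fixes n :: nat and l :: "'e \<Rightarrow> nat" and F :: "(nat \<Rightarrow> nat) set"
  assumes tree: "serre_tree T arev"
    and legal: "legal_labelling n T arev l"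
    and F: "subgroup F (sym_group n)"
begin

abbreviation "Aut \<equiv> aut_group T arev"

abbreviation \<sigma> where "\<sigma> \<equiv> local_action n T l"

lemma Aut_group: "group Aut"
  by (rule aut_group_is_group) (rule bidirected_digraph)

lemma Aut_mult: "fst (g \<otimes>\<^bsub>Aut\<^esub> h) x = fst g (fst h x)" "snd (g \<otimes>\<^bsub>Aut\<^esub> h) e = snd g (snd h e)"
  by (simp_all add: aut_group_def)

lemma Aut_one: "fst \<one>\<^bsub>Aut\<^esub> x = x" "snd \<one>\<^bsub>Aut\<^esub> e = e"
  by (simp_all add: aut_group_def)

lemma Aut_inv:
  assumes "g \<in> carrier Aut"
  shows "fst (inv\<^bsub>Aut\<^esub> g) (fst g x) = x" "fst g (fst (inv\<^bsub>Aut\<^esub> g) x) = x"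
    "snd (inv\<^bsub>Aut\<^esub> g) (snd g e) = e" "snd g (snd (inv\<^bsub>Aut\<^esub> g) e) = e"
  using group.l_inv[OF Aut_group assms] group.r_inv[OF Aut_group assms]
  by (metis Aut_mult Aut_one)+

lemma Aut_closed:
  assumes "g \<in> carrier Aut"
  shows "x \<in> verts T \<Longrightarrow> fst g x \<in> verts T" "e \<in> arcs T \<Longrightarrow> snd g e \<in> arcs T"
    "e \<in> arcs T \<Longrightarrow> tail T (snd g e) = fst g (tail T e)"
    "e \<in> arcs T \<Longrightarrow> head T (snd g e) = fst g (head T e)"
    "e \<in> arcs T \<Longrightarrow> snd g (arev e) = arev (snd g e)"
  using assms by (auto simp: aut_group_def permutes_in_image)

lemma F_permutes: "\<pi> \<in> F \<Longrightarrow> \<pi> permutes {1..n}"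
  using subgroup.mem_carrier[OF F] by (simp add: sym_group_carrier)

lemma F_id: "id \<in> F"
  using subgroup.one_closed[OF F] by (simp add: sym_group_one)

lemma F_comp: "\<pi> \<in> F \<Longrightarrow> \<rho> \<in> F \<Longrightarrow> \<pi> \<circ> \<rho> \<in> F"
  using subgroup.m_closed[OF F] by (simp add: sym_group_mult)

lemma F_inv: "\<pi> \<in> F \<Longrightarrow> inv' \<pi> \<in> F"
  using subgroup.m_inv_closed[OF F] subgroup.mem_carrier[OF F]
  by (metis sym_group_inv_equality)

lemma F_cancel: "\<pi> \<in> F \<Longrightarrow> \<pi> \<circ> inv' \<pi> = id" "\<pi> \<in> F \<Longrightarrow> inv' \<pi> \<circ> \<pi> = id"
  using F_permutes permutes_inv_o by blast+

lemma finite_F: "finite F"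
  using F_permutes finite_permutations[of "{1..n}"] by (metis finite_atLeastAtMost finite_subset mem_Collect_eq subsetI)

lemma local_action_label: "e \<in> arcs T \<Longrightarrow> \<sigma> g (tail T e) (l e) = l (snd g e)"
proof -
  assume e: "e \<in> arcs T"
  then have "inj_on l (out_arcs T (tail T e))"
    using legal by (auto simp: legal_labelling_def bij_betw_def)
  then have "inv_into (out_arcs T (tail T e)) l (l e) = e" using e by simp
  then show ?thesis
    using legal_labelling_range[OF legal wf_digraph_axioms e] by (simp add: local_action_def)
qed

lemma local_action_outside: "i \<notin> {1..n} \<Longrightarrow> \<sigma> g x i = i"
  by (simp add: local_action_def)

lemma local_action_eqI:
  assumes "x \<in> verts T" and "\<And>i. i \<notin> {1..n} \<Longrightarrow> \<pi> i = i"
    and "\<And>e. e \<in> arcs T \<Longrightarrow> tail T e = x \<Longrightarrow> l (snd g e) = \<pi> (l e)"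
  shows "\<sigma> g x = \<pi>"
proof
  fix i
  show "\<sigma> g x i = \<pi> i"
  proof (cases "i \<in> {1..n}")
    case True
    then obtain e where "e \<in> arcs T" "tail T e = x" "l e = i"
      using legal_labelling_surjD[OF legal assms(1)] by blast
    then show ?thesis using assms(3) local_action_label by metis
  qed (simp add: assms(2) local_action_outside)
qed

lemma local_action_mult:
  assumes "h \<in> carrier Aut" "x \<in> verts T"
  shows "\<sigma> (g \<otimes>\<^bsub>Aut\<^esub> h) x = \<sigma> g (fst h x) \<circ> \<sigma> h x"
proof (rule local_action_eqI)
  fix e assume e: "e \<in> arcs T" "tail T e = x"
  then show "l (snd (g \<otimes>\<^bsub>Aut\<^esub> h) e) = (\<sigma> g (fst h x) \<circ> \<sigma> h x) (l e)"
    using local_action_label[of "snd h e" g] local_action_label[of e h] Aut_closed[OF assms(1)]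
    by (auto simp: Aut_mult)
qed (use assms in \<open>auto simp: local_action_outside\<close>)

lemma local_action_one: "x \<in> verts T \<Longrightarrow> \<sigma> \<one>\<^bsub>Aut\<^esub> x = id"
  by (rule local_action_eqI) (auto simp: Aut_one)

text \<open>
  For \<open>F\<close> trivial these are the label-preserving automorphisms, a simply transitive group generated
  by the inversions of the edges at one vertex. In general \<open>\<Lambda>\<close> is the semidirect product of
  that group with \<open>F\<close>, which permutes the generators.
\<close>

definition \<Lambda> where
  "\<Lambda> = {g \<in> carrier Aut. \<exists>\<pi> \<in> F. \<forall>x \<in> verts T. \<sigma> g x = \<pi>}"

lemma \<Lambda>_subgroup: "subgroup \<Lambda> Aut"
proof (rule group.subgroupI[OF Aut_group])
  show "\<Lambda> \<subseteq> carrier Aut" by (auto simp: \<Lambda>_def)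
  have "\<one>\<^bsub>Aut\<^esub> \<in> \<Lambda>"
    using local_action_one F_id monoid.one_closed[OF group.is_monoid[OF Aut_group]]
    by (auto simp: \<Lambda>_def)
  then show "\<Lambda> \<noteq> {}" by blast
next
  fix g assume g: "g \<in> \<Lambda>"
  then obtain \<pi> where \<pi>: "\<pi> \<in> F" "\<And>x. x \<in> verts T \<Longrightarrow> \<sigma> g x = \<pi>" and gA: "g \<in> carrier Aut"
    by (auto simp: \<Lambda>_def)
  have gi: "inv\<^bsub>Aut\<^esub> g \<in> carrier Aut" using gA group.inv_closed[OF Aut_group] by blast
  have "\<sigma> (inv\<^bsub>Aut\<^esub> g) x = inv' \<pi>" if "x \<in> verts T" for x
  proof -
    have "\<pi> \<circ> \<sigma> (inv\<^bsub>Aut\<^esub> g) x = id"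
      using local_action_mult[OF gi that, of g] local_action_one[OF that] \<pi>(2)
        Aut_closed(1)[OF gi that] group.r_inv[OF Aut_group gA] by simp
    then have "inv' \<pi> \<circ> \<pi> \<circ> \<sigma> (inv\<^bsub>Aut\<^esub> g) x = inv' \<pi>" by (simp add: comp_assoc)
    then show ?thesis using F_cancel(2)[OF \<pi>(1)] by simp
  qed
  then show "inv\<^bsub>Aut\<^esub> g \<in> \<Lambda>" using gi F_inv[OF \<pi>(1)] by (auto simp: \<Lambda>_def)
next
  fix g h assume "g \<in> \<Lambda>" "h \<in> \<Lambda>"
  then obtain \<pi> \<rho> where \<pi>: "\<pi> \<in> F" "\<And>x. x \<in> verts T \<Longrightarrow> \<sigma> g x = \<pi>" and gA: "g \<in> carrier Aut"
    and \<rho>: "\<rho> \<in> F" "\<And>x. x \<in> verts T \<Longrightarrow> \<sigma> h x = \<rho>" and hA: "h \<in> carrier Aut"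
    by (auto simp: \<Lambda>_def)
  have "\<sigma> (g \<otimes>\<^bsub>Aut\<^esub> h) x = \<pi> \<circ> \<rho>" if "x \<in> verts T" for x
    using local_action_mult[OF hA that] \<pi>(2) \<rho>(2) Aut_closed(1)[OF hA that] that by simp
  moreover have "g \<otimes>\<^bsub>Aut\<^esub> h \<in> carrier Aut"
    using gA hA group.is_monoid[OF Aut_group] by (simp add: monoid.m_closed)
  ultimately show "g \<otimes>\<^bsub>Aut\<^esub> h \<in> \<Lambda>" using F_comp[OF \<pi>(1) \<rho>(1)] by (auto simp: \<Lambda>_def)
qed

lemma \<Lambda>_uniform_lattice: "uniform_lattice T arev \<Lambda>"
  unfolding uniform_lattice_def
proof (intro conjI ballI)
  fix x assume x: "x \<in> verts T"
  let ?S = "stabilizer (Aut\<lparr>carrier := \<Lambda>\<rparr>) fst x"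
  have S: "?S = {g \<in> \<Lambda>. fst g x = x}" by (simp add: stabilizer_def)
  have "inj_on (\<lambda>g. \<sigma> g x) ?S"
  proof (rule inj_onI)
    fix g h assume g: "g \<in> ?S" and h: "h \<in> ?S" and eq: "\<sigma> g x = \<sigma> h x"
    then have "g \<in> \<Lambda>" "h \<in> \<Lambda>" by (auto simp: S)
    then have gA: "g \<in> carrier Aut" and hA: "h \<in> carrier Aut" by (auto simp: \<Lambda>_def)
    have "\<sigma> g y = \<sigma> h y" if "y \<in> verts T" for y
      using \<open>g \<in> \<Lambda>\<close> \<open>h \<in> \<Lambda>\<close> eq x that by (auto simp: \<Lambda>_def)
    then have "l (snd g e) = l (snd h e)" if "e \<in> arcs T" for e
      using that local_action_label by (metis tail_in_verts)
    with graph_map_unique[OF tree legal graph_map_if_aut[OF gA] graph_map_if_aut[OF hA] x] g h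
    show "g = h" by (intro aut_eqI[OF gA hA]) (auto simp: S)
  qed
  moreover have "\<sigma> g x \<in> F" if "g \<in> \<Lambda>" for g using that x by (auto simp: \<Lambda>_def)
  then have "(\<lambda>g. \<sigma> g x) ` ?S \<subseteq> F" by (auto simp: S)
  ultimately show "finite ?S" using finite_F by (meson finite_imageD finite_subset)
next
  have "orbit (Aut\<lparr>carrier := \<Lambda>\<rparr>) fst x = verts T" if x: "x \<in> verts T" for x
  proof
    show "orbit (Aut\<lparr>carrier := \<Lambda>\<rparr>) fst x \<subseteq> verts T"
      using x Aut_closed(1) by (auto simp: orbit_def \<Lambda>_def)
    show "verts T \<subseteq> orbit (Aut\<lparr>carrier := \<Lambda>\<rparr>) fst x"
    proof
      fix y assume "y \<in> verts T"
      then obtain g where g: "g \<in> carrier Aut" "fst g x = y" "\<And>e. e \<in> arcs T \<Longrightarrow> l (snd g e) = l e"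
        using aut_carrying_labelling[OF tree legal legal x] by blast
      have "\<sigma> g z = id" if "z \<in> verts T" for z
        using that g(3) by (intro local_action_eqI) auto
      then have "g \<in> \<Lambda>" using g(1) F_id by (auto simp: \<Lambda>_def)
      then show "y \<in> orbit (Aut\<lparr>carrier := \<Lambda>\<rparr>) fst x"
        using g(2) by (auto simp: orbit_def simp del: split_paired_Ex)
    qed
  qed
  then have "orbits (Aut\<lparr>carrier := \<Lambda>\<rparr>) (verts T) fst \<subseteq> {verts T}" by (auto simp: orbits_def)
  then show "finite (orbits (Aut\<lparr>carrier := \<Lambda>\<rparr>) (verts T) fst)" by (rule finite_subset) simp
qed (rule \<Lambda>_subgroup)

lemma \<Lambda>_subset_universal_group: "\<Lambda> \<subseteq> universal_group n T arev l F"
  by (auto simp: \<Lambda>_def universal_group_def)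

section \<open>Conjugating a free group\<close>

text \<open>
  Pick one edge in each \<open>\<Gamma>\<close>-orbit of unoriented edges. By freeness a unique \<open>\<gamma> e \<in> \<Gamma>\<close>
  brings \<open>e\<close> to the chosen edge, up to orientation; uniqueness gives the last two properties.
\<close>

lemma equivariant_arc_choice:
  assumes \<Gamma>: "subgroup \<Gamma> Aut" and free: "acts_freely T arev \<Gamma>"
  obtains \<gamma> where "\<And>e. e \<in> arcs T \<Longrightarrow> \<gamma> e \<in> \<Gamma>" "\<And>e. e \<in> arcs T \<Longrightarrow> \<gamma> (arev e) = \<gamma> e"
    "\<And>e \<delta>. e \<in> arcs T \<Longrightarrow> \<delta> \<in> \<Gamma> \<Longrightarrow> \<gamma> (snd \<delta> e) \<otimes>\<^bsub>Aut\<^esub> \<delta> = \<gamma> e"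
proof -
  have \<Gamma>A: "\<delta> \<in> carrier Aut" if "\<delta> \<in> \<Gamma>" for \<delta> using subgroup.mem_carrier[OF \<Gamma> that] .
  define orb where "orb e = {snd \<delta> a | \<delta> a. \<delta> \<in> \<Gamma> \<and> (a = e \<or> a = arev e)}" for e
  define rep where "rep e = (SOME a. a \<in> orb e)" for e
  define good where "good e \<delta> \<longleftrightarrow> \<delta> \<in> \<Gamma> \<and> (snd \<delta> e = rep e \<or> snd \<delta> e = arev (rep e))" for e \<delta>
  define \<gamma> where "\<gamma> e = (THE \<delta>. good e \<delta>)" for e
  have unique: "\<delta> = \<delta>'" if e: "e \<in> arcs T" and "good e \<delta>" "good e \<delta>'" for e \<delta> \<delta>'
  proof -
    \<comment> \<open>Two candidates differ by an element fixing or inverting \<open>e\<close>.\<close>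
    let ?\<epsilon> = "inv\<^bsub>Aut\<^esub> \<delta>' \<otimes>\<^bsub>Aut\<^esub> \<delta>"
    have d: "\<delta> \<in> \<Gamma>" "\<delta>' \<in> \<Gamma>" using that by (auto simp: good_def)
    have "snd \<delta> e = snd \<delta>' e \<or> snd \<delta> e = arev (snd \<delta>' e)"
      using that by (auto simp: good_def)
    then have "snd \<delta> e = snd \<delta>' e \<or> snd \<delta> e = snd \<delta>' (arev e)"
      using Aut_closed(5)[OF \<Gamma>A[OF d(2)] e] by simp
    then have "snd ?\<epsilon> e = e \<or> snd ?\<epsilon> e = arev e"
      using Aut_inv(3)[OF \<Gamma>A[OF d(2)]] by (auto simp: Aut_mult)
    moreover have "?\<epsilon> \<in> \<Gamma>"
      using \<Gamma> d by (simp add: subgroup.m_closed subgroup.m_inv_closed)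
    ultimately have "?\<epsilon> = \<one>\<^bsub>Aut\<^esub>" using free e by (auto simp: acts_freely_def)
    then show ?thesis
      using group.inv_solve_left[OF Aut_group] d \<Gamma>A group.is_monoid[OF Aut_group]
      by (metis group.inv_closed[OF Aut_group] group.inv_inv[OF Aut_group] group.inv_equality[OF Aut_group])
  qed
  have good: "good e (\<gamma> e)" if e: "e \<in> arcs T" for e
  proof -
    have "snd \<one>\<^bsub>Aut\<^esub> e \<in> orb e" using subgroup.one_closed[OF \<Gamma>] unfolding orb_def by blast
    then have "rep e \<in> orb e" unfolding rep_def by (rule someI)
    then obtain \<delta> a where d: "\<delta> \<in> \<Gamma>" "rep e = snd \<delta> a" "a = e \<or> a = arev e"
      by (auto simp: orb_def)
    then have "good e \<delta>" using Aut_closed(5)[OF \<Gamma>A[OF d(1)] e] by (auto simp: good_def)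
    then show ?thesis unfolding \<gamma>_def using unique[OF e] by (metis theI)
  qed
  show ?thesis
  proof (rule that)
    fix e assume e: "e \<in> arcs T"
    show "\<gamma> e \<in> \<Gamma>" using good[OF e] by (simp add: good_def)
    have "orb (arev e) = orb e" by (auto simp: orb_def)
    then have "rep (arev e) = rep e" by (simp add: rep_def)
    then have "good e \<delta> = good (arev e) \<delta>" if "\<delta> \<in> \<Gamma>" for \<delta>
      using Aut_closed(5)[OF \<Gamma>A[OF that] e] \<open>rep (arev e) = rep e\<close>
      unfolding good_def by (metis arev_arev)
    then have "good e (\<gamma> (arev e))"
      using good[of "arev e"] e by (auto simp: good_def)
    then show "\<gamma> (arev e) = \<gamma> e" using unique[OF e] good[OF e] by blast
    fix \<delta> assume \<delta>: "\<delta> \<in> \<Gamma>"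
    note \<delta>A = \<Gamma>A[OF \<delta>]
    have "orb (snd \<delta> e) = orb e"
    proof
      have "\<epsilon> \<otimes>\<^bsub>Aut\<^esub> \<delta> \<in> \<Gamma>" if "\<epsilon> \<in> \<Gamma>" for \<epsilon> using that \<Gamma> \<delta> by (simp add: subgroup.m_closed)
      moreover have "snd \<epsilon> (snd \<delta> a) = snd (\<epsilon> \<otimes>\<^bsub>Aut\<^esub> \<delta>) a" for \<epsilon> a by (simp add: Aut_mult)
      ultimately show "orb (snd \<delta> e) \<subseteq> orb e"
        using Aut_closed(5)[OF \<delta>A e] unfolding orb_def by (smt (verit) mem_Collect_eq subsetI)
      have "\<epsilon> \<otimes>\<^bsub>Aut\<^esub> inv\<^bsub>Aut\<^esub> \<delta> \<in> \<Gamma>" if "\<epsilon> \<in> \<Gamma>" for \<epsilon>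
        using that \<Gamma> \<delta> by (simp add: subgroup.m_closed subgroup.m_inv_closed)
      moreover have "snd \<epsilon> a = snd (\<epsilon> \<otimes>\<^bsub>Aut\<^esub> inv\<^bsub>Aut\<^esub> \<delta>) (snd \<delta> a)" for \<epsilon> a
        by (simp add: Aut_mult Aut_inv(3)[OF \<delta>A])
      ultimately show "orb e \<subseteq> orb (snd \<delta> e)"
        using Aut_closed(5)[OF \<delta>A e] unfolding orb_def by (smt (verit) mem_Collect_eq subsetI)
    qed
    then have "rep (snd \<delta> e) = rep e" by (simp add: rep_def)
    then have "good e (\<gamma> (snd \<delta> e) \<otimes>\<^bsub>Aut\<^esub> \<delta>)"
      using good[OF Aut_closed(2)[OF \<delta>A e]] \<Gamma> \<delta>
      by (auto simp: good_def Aut_mult subgroup.m_closed)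
    then show "\<gamma> (snd \<delta> e) \<otimes>\<^bsub>Aut\<^esub> \<delta> = \<gamma> e" using unique[OF e] good[OF e] by blast
  qed
qed

text \<open>
  The connection, written in labels: \<open>d e\<close> identifies the star at the head of \<open>e\<close> with the star
  at its tail. On the chosen edges it is the identity of \<open>{1..n}\<close>, and elsewhere it is
  pulled back by \<open>\<gamma> e\<close>; hence it lies in \<open>F\<close>. It fixes \<open>l e\<close> because \<open>e\<close> and its
  inverse have equal labels both before and after applying \<open>\<gamma> e\<close>. The last property is
  \<open>\<Gamma>\<close>-equivariance.
\<close>

lemma equivariant_star_identification:
  assumes \<Gamma>: "subgroup \<Gamma> Aut" and U: "\<Gamma> \<subseteq> universal_group n T arev l F"
    and free: "acts_freely T arev \<Gamma>"
  obtains d where "\<And>e. e \<in> arcs T \<Longrightarrow> d e \<in> F" "\<And>e. e \<in> arcs T \<Longrightarrow> d (arev e) = inv' (d e)"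
    "\<And>e. e \<in> arcs T \<Longrightarrow> d e (l e) = l e"
    "\<And>e \<delta>. e \<in> arcs T \<Longrightarrow> \<delta> \<in> \<Gamma> \<Longrightarrow>
       d (snd \<delta> e) \<circ> \<sigma> \<delta> (head T e) = \<sigma> \<delta> (tail T e) \<circ> d e"
proof -
  obtain \<gamma> where \<gamma>: "\<And>e. e \<in> arcs T \<Longrightarrow> \<gamma> e \<in> \<Gamma>" "\<And>e. e \<in> arcs T \<Longrightarrow> \<gamma> (arev e) = \<gamma> e"
    "\<And>e \<delta>. e \<in> arcs T \<Longrightarrow> \<delta> \<in> \<Gamma> \<Longrightarrow> \<gamma> (snd \<delta> e) \<otimes>\<^bsub>Aut\<^esub> \<delta> = \<gamma> e"
    using equivariant_arc_choice[OF \<Gamma> free] by blast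
  have \<sigma>F: "\<sigma> \<delta> x \<in> F" if "\<delta> \<in> \<Gamma>" "x \<in> verts T" for \<delta> x
    using U that by (auto simp: universal_group_def)
  define d where "d e = inv' (\<sigma> (\<gamma> e) (tail T e)) \<circ> \<sigma> (\<gamma> e) (head T e)" for e
  show ?thesis
  proof (rule that)
    fix e assume e: "e \<in> arcs T"
    have F': "\<sigma> (\<gamma> e) (tail T e) \<in> F" "\<sigma> (\<gamma> e) (head T e) \<in> F" using \<sigma>F \<gamma>(1) e by auto
    note bij = F'[THEN F_permutes, THEN permutes_bij]
    show "d e \<in> F" using F' by (simp add: d_def F_comp F_inv)
    show "d (arev e) = inv' (d e)"
      using e bij by (simp add: d_def \<gamma>(2) o_inv_distrib bij_imp_bij_inv inv_inv_eq)
    have "\<sigma> (\<gamma> e) (head T e) (l e) = l (snd (\<gamma> e) (arev e))"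
      using local_action_label[of "arev e" "\<gamma> e"] e legal by (simp add: legal_labelling_def)
    also have "\<dots> = l (snd (\<gamma> e) e)"
      using \<gamma>(1)[OF e] \<Gamma> e legal Aut_closed(2,5)
      by (simp add: subgroup.mem_carrier legal_labelling_def)
    also have "\<dots> = \<sigma> (\<gamma> e) (tail T e) (l e)" by (simp add: local_action_label e)
    finally show "d e (l e) = l e" using bij by (simp add: d_def bij_is_inj)
    fix \<delta> assume \<delta>: "\<delta> \<in> \<Gamma>"
    then have \<delta>A: "\<delta> \<in> carrier Aut" using \<Gamma> by (simp add: subgroup.mem_carrier)
    let ?e = "snd \<delta> e" and ?x = "tail T e" and ?y = "head T e"
    have e': "?e \<in> arcs T" "tail T ?e = fst \<delta> ?x" "head T ?e = fst \<delta> ?y"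
      using Aut_closed[OF \<delta>A] e by auto
    have eq: "\<sigma> (\<gamma> e) z = \<sigma> (\<gamma> ?e) (fst \<delta> z) \<circ> \<sigma> \<delta> z" if "z \<in> verts T" for z
      using local_action_mult[OF \<delta>A that, of "\<gamma> ?e"] \<gamma>(3)[OF e \<delta>] by simp
    define s where "s = \<sigma> (\<gamma> ?e) (fst \<delta> ?x)"
    have s: "s \<in> F" "\<sigma> \<delta> ?x \<in> F" using \<sigma>F \<gamma>(1) e' \<delta> Aut_closed(1)[OF \<delta>A] e by (auto simp: s_def)
    have "inv' (s \<circ> \<sigma> \<delta> ?x) = inv' (\<sigma> \<delta> ?x) \<circ> inv' s"
      using s F_permutes permutes_bij by (metis o_inv_distrib)
    then have cancel: "\<sigma> \<delta> ?x \<circ> inv' (s \<circ> \<sigma> \<delta> ?x) = inv' s"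
      using F_cancel(1)[OF s(2)] by (simp flip: comp_assoc)
    have "\<sigma> \<delta> ?x \<circ> d e = (\<sigma> \<delta> ?x \<circ> inv' (s \<circ> \<sigma> \<delta> ?x)) \<circ> (\<sigma> (\<gamma> ?e) (fst \<delta> ?y) \<circ> \<sigma> \<delta> ?y)"
      using eq[of ?x] eq[of ?y] e by (simp add: d_def s_def comp_assoc)
    also have "\<dots> = d ?e \<circ> \<sigma> \<delta> ?y"
      unfolding cancel by (simp add: d_def s_def e' comp_assoc)
    finally show "d ?e \<circ> \<sigma> \<delta> ?y = \<sigma> \<delta> ?x \<circ> d e" by simp
  qed
qed

text \<open>
  Here \<open>s x\<close> expresses the transported labels at \<open>x\<close> in terms of the original ones, and \<open>k x\<close> is
  the local action of \<open>\<delta>\<close> at \<open>x\<close> in the transported labels. Equivariance of the connection says that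
  \<open>k\<close> does not change along an edge.
\<close>

lemma free_subgroup_conjugates_into_\<Lambda>:
  assumes \<Gamma>: "subgroup \<Gamma> Aut" and U: "\<Gamma> \<subseteq> universal_group n T arev l F"
    and free: "acts_freely T arev \<Gamma>"
  obtains g where "g \<in> universal_group n T arev l F"
    "\<And>\<delta>. \<delta> \<in> \<Gamma> \<Longrightarrow> g \<otimes>\<^bsub>Aut\<^esub> \<delta> \<otimes>\<^bsub>Aut\<^esub> inv\<^bsub>Aut\<^esub> g \<in> \<Lambda>"
proof -
  obtain d where d: "\<And>e. e \<in> arcs T \<Longrightarrow> d e \<in> F" "\<And>e. e \<in> arcs T \<Longrightarrow> d (arev e) = inv' (d e)"
    "\<And>e. e \<in> arcs T \<Longrightarrow> d e (l e) = l e"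
    "\<And>e \<delta>. e \<in> arcs T \<Longrightarrow> \<delta> \<in> \<Gamma> \<Longrightarrow>
       d (snd \<delta> e) \<circ> \<sigma> \<delta> (head T e) = \<sigma> \<delta> (tail T e) \<circ> d e"
    using equivariant_star_identification[OF \<Gamma> U free] by blast
  obtain x0 where x0: "x0 \<in> verts T"
    using strongly_connected_if_serre_tree[OF tree] by (auto simp: strongly_connected_def)
  have inv: "(s \<circ> d e) \<circ> d (arev e) = s" if "e \<in> arcs T" for s :: "nat \<Rightarrow> nat" and e
    using d(2)[OF that] F_cancel(1)[OF d(1)[OF that]] by (simp add: comp_assoc)
  obtain s where sF: "\<And>x. x \<in> verts T \<Longrightarrow> s x \<in> F"
    and s: "\<And>e. e \<in> arcs T \<Longrightarrow> s (head T e) = s (tail T e) \<circ> d e"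
    using transport_exists[OF tree, of F "\<lambda>e a. a \<circ> d e" x0 id] F_comp d(1) inv x0 F_id by metis
  define l' where "l' e = s (tail T e) (l e)" for e
  have l': "legal_labelling n T arev l'"
    unfolding legal_labelling_def
  proof (intro conjI ballI)
    fix x assume x: "x \<in> verts T"
    have "bij_betw (s x \<circ> l) (out_arcs T x) {1..n}"
      using x legal permutes_imp_bij[OF F_permutes[OF sF[OF x]]]
      by (auto simp: legal_labelling_def intro: bij_betw_trans)
    then show "bij_betw l' (out_arcs T x) {1..n}"
      by (rule bij_betw_cong[THEN iffD1, rotated]) (auto simp: l'_def)
  next
    fix e assume e: "e \<in> arcs T"
    then show "l' (arev e) = l' e"
      using legal d(3)[OF e] by (simp add: l'_def s legal_labelling_def)
  qed
  obtain g where g: "g \<in> carrier Aut" "\<And>e. e \<in> arcs T \<Longrightarrow> l (snd g e) = l' e"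
    using aut_carrying_labelling[OF tree legal l' x0 x0] by blast
  have \<sigma>g: "\<sigma> g x = s x" if "x \<in> verts T" for x
    using that F_permutes[OF sF[OF that]] g(2)
    by (intro local_action_eqI) (auto simp: l'_def permutes_not_in)
  show ?thesis
  proof (rule that)
    show "g \<in> universal_group n T arev l F" using g(1) \<sigma>g sF by (simp add: universal_group_def)
  next
    fix \<delta> assume \<delta>: "\<delta> \<in> \<Gamma>"
    then have \<delta>A: "\<delta> \<in> carrier Aut" using \<Gamma> by (simp add: subgroup.mem_carrier)
    define k where "k x = s (fst \<delta> x) \<circ> \<sigma> \<delta> x \<circ> inv' (s x)" for x
    have kF: "k x \<in> F" if "x \<in> verts T" for x
      using that sF Aut_closed(1)[OF \<delta>A] U \<delta> by (auto simp: k_def universal_group_def F_comp F_inv)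
    have k_const: "k x = k x0" if "x \<in> verts T" for x
      using tree x0 that
    proof (induction rule: serre_tree_induct)
      case (step e)
      let ?x = "tail T e" and ?y = "head T e"
      have sy: "s (fst \<delta> ?y) = s (fst \<delta> ?x) \<circ> d (snd \<delta> e)"
        using s[of "snd \<delta> e"] Aut_closed[OF \<delta>A] step by simp
      have "inv' (s ?y) = inv' (d e) \<circ> inv' (s ?x)"
        using s d(1) sF step F_permutes permutes_bij o_inv_distrib by (metis tail_in_verts)
      then have "k ?y = s (fst \<delta> ?x) \<circ> (d (snd \<delta> e) \<circ> \<sigma> \<delta> ?y) \<circ> inv' (d e) \<circ> inv' (s ?x)"
        by (simp add: k_def sy comp_assoc)
      also have "\<dots> = s (fst \<delta> ?x) \<circ> \<sigma> \<delta> ?x \<circ> (d e \<circ> inv' (d e)) \<circ> inv' (s ?x)"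
        using d(4)[OF step(1) \<delta>] by (simp add: comp_assoc)
      also have "\<dots> = k ?x" using F_cancel(1)[OF d(1)[OF step(1)]] by (simp add: k_def)
      finally show ?case using step by simp
    qed simp
    let ?c = "g \<otimes>\<^bsub>Aut\<^esub> \<delta> \<otimes>\<^bsub>Aut\<^esub> inv\<^bsub>Aut\<^esub> g"
    interpret Aut: group Aut by (rule Aut_group)
    have cA: "?c \<in> carrier Aut" using g(1) \<delta>A by simp
    have "\<sigma> ?c y = k x0" if y: "y \<in> verts T" for y
    proof -
      define x where "x = fst (inv\<^bsub>Aut\<^esub> g) y"
      have x: "x \<in> verts T" "fst g x = y"
        using y g(1) Aut_closed(1) Aut_inv by (auto simp: x_def)
      have "?c \<otimes>\<^bsub>Aut\<^esub> g = g \<otimes>\<^bsub>Aut\<^esub> \<delta>" using g(1) \<delta>A by (simp add: Aut.m_assoc)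
      then have "\<sigma> ?c y \<circ> s x = s (fst \<delta> x) \<circ> \<sigma> \<delta> x"
        using local_action_mult[OF g(1) x(1), of ?c] local_action_mult[OF \<delta>A x(1), of g]
          \<sigma>g Aut_closed(1)[OF \<delta>A x(1)] x by simp
      then have "\<sigma> ?c y \<circ> (s x \<circ> inv' (s x)) = k x" by (simp add: k_def flip: comp_assoc)
      then show ?thesis using F_cancel(1)[OF sF[OF x(1)]] k_const[OF x(1)] by simp
    qed
    then show "?c \<in> \<Lambda>" using cA kF[OF x0] by (auto simp: \<Lambda>_def)
  qed
qed

end

theorem theorem1p5:
  fixes n :: nat
    and T :: "('v, 'e) pre_digraph"
    and arev :: "'e \<Rightarrow> 'e"
    and l :: "'e \<Rightarrow> nat"
    and F :: "(nat \<Rightarrow> nat) set"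
  assumes "n \<ge> 3"
    and "regular_tree n T arev"
    and "legal_labelling n T arev l"
    and "subgroup F (sym_group n)"
  shows "\<exists>\<Lambda>. uniform_lattice T arev \<Lambda> \<and> \<Lambda> \<subseteq> universal_group n T arev l F \<and>
    (\<forall>\<Gamma>. uniform_lattice T arev \<Gamma> \<and> \<Gamma> \<subseteq> universal_group n T arev l F \<and> acts_freely T arev \<Gamma> \<longrightarrow>
      (\<exists>g \<in> universal_group n T arev l F.
         g <#\<^bsub>aut_group T arev\<^esub> \<Gamma> #>\<^bsub>aut_group T arev\<^esub> (inv\<^bsub>aut_group T arev\<^esub> g) \<subseteq> \<Lambda>))"
proof -
  have "serre_tree T arev" using assms(2) by (simp add: regular_tree_def)
  then interpret labelled_tree T arev n l F
    using assms(3,4) by (simp add: labelled_tree_def labelled_tree_axioms_def serre_tree_def)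
  show ?thesis
  proof (intro exI[of _ \<Lambda>] conjI allI impI)
    fix \<Gamma>
    assume \<Gamma>: "uniform_lattice T arev \<Gamma> \<and> \<Gamma> \<subseteq> universal_group n T arev l F \<and> acts_freely T arev \<Gamma>"
    then obtain g where "g \<in> universal_group n T arev l F"
      "\<And>\<delta>. \<delta> \<in> \<Gamma> \<Longrightarrow> g \<otimes>\<^bsub>Aut\<^esub> \<delta> \<otimes>\<^bsub>Aut\<^esub> inv\<^bsub>Aut\<^esub> g \<in> \<Lambda>"
      using free_subgroup_conjugates_into_\<Lambda>[of \<Gamma>] by (auto simp: uniform_lattice_def)
    then show "\<exists>g \<in> universal_group n T arev l F. g <#\<^bsub>Aut\<^esub> \<Gamma> #>\<^bsub>Aut\<^esub> (inv\<^bsub>Aut\<^esub> g) \<subseteq> \<Lambda>"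
      by (intro bexI[of _ g]) (auto simp: l_coset_def r_coset_def)
  qed (fact \<Lambda>_uniform_lattice \<Lambda>_subset_universal_group)+
qed

end
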